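(* Let $0<\alpha<1$ and let $x,y$ be sufficiently smooth functions on $[0,T]$. For any constants $a,b\in\mathbb R$, $${}^c\mathcal D_\Phi^\alpha(ax+by)(t)=a\,{}^c\mathcal D_\Phi^\alpha x(t)+b\,{}^c\mathcal D_\Phi^\alpha y(t).$$
   Context: Let $T>0$. A dynamic memory generator is a positive function $\Phi(p,\Theta)$ of the Laplace variable $p\in(0,\infty)$ and of fixed modulation parameters $\Theta$. For $\gamma>0$ the dynamic-memory kernel is $\Psi_\gamma(t;\Theta)=\mathcal L^{-1}\{\Phi(p,\Theta)^{-\gamma}\}(t)$, i.e. the locally integrable function on $(0,\infty)$ whose Laplace transform is $\Phi(p,\Theta)^{-\gamma}$. For $0<\alpha<1$ the Caputo dynamic-memory fractional derivative is $({}^c\mathcal D_\Phi^\alpha x)(t)=\int_0^t\Psi_{1-\alpha}(t-s;\Theta)x'(s)\,ds$, $t\in[0,T]$. "Sufficiently smooth" means smooth enough for the derivatives and integrals involved to be well defined (e.g. continuously differentiable on $[0,T]$). *)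

theory Defs
  imports "HOL-Analysis.Analysis"
begin

text \<open>
  The Laplace integral is the limit of its truncations, so absolute convergence at infinity is not
  required. Integrability up to the endpoint 0 is part of the condition: it is what makes every
  truncated Laplace integral an honest Lebesgue integral.
\<close>

definition has_laplace_transform :: "(real \<Rightarrow> real) \<Rightarrow> (real \<Rightarrow> real) \<Rightarrow> bool" where
  "has_laplace_transform f F \<longleftrightarrow>
     (\<forall>R>0. set_integrable lborel {0<..R} f) \<and>
     (\<forall>p>0. ((\<lambda>R. LBINT t:{0<..R}. exp (- p * t) * f t) \<longlongrightarrow> F p) at_top)"

text \<open>
  A locally integrable function is determined by its Laplace transform only almost everywhere,
  hence the choice of a representative. The result is meaningful only if some \<open>f\<close> with
  \<open>has_laplace_transform f F\<close> exists.
\<close>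

definition inverse_laplace :: "(real \<Rightarrow> real) \<Rightarrow> real \<Rightarrow> real" where
  "inverse_laplace F = (SOME f. has_laplace_transform f F)"

definition dm_generator :: "(real \<Rightarrow> 'm \<Rightarrow> real) \<Rightarrow> 'm \<Rightarrow> bool" where
  "dm_generator \<Phi> \<Theta> \<longleftrightarrow> (\<forall>p>0. \<Phi> p \<Theta> > 0)"

definition has_dm_kernel :: "(real \<Rightarrow> 'm \<Rightarrow> real) \<Rightarrow> 'm \<Rightarrow> real \<Rightarrow> bool" where
  "has_dm_kernel \<Phi> \<Theta> \<gamma> \<longleftrightarrow> (\<exists>f. has_laplace_transform f (\<lambda>p. \<Phi> p \<Theta> powr (- \<gamma>)))"

definition dm_kernel :: "(real \<Rightarrow> 'm \<Rightarrow> real) \<Rightarrow> 'm \<Rightarrow> real \<Rightarrow> real \<Rightarrow> real" where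
  "dm_kernel \<Phi> \<Theta> \<gamma> = inverse_laplace (\<lambda>p. \<Phi> p \<Theta> powr (- \<gamma>))"

text \<open>
  Functions on \<open>[0,T]\<close> are total functions whose values outside \<open>[0,T]\<close> are irrelevant; the
  derivative is taken within \<open>[0,T]\<close>, hence one-sided at the endpoints.
\<close>

definition caputo_integrand ::
    "real \<Rightarrow> (real \<Rightarrow> 'm \<Rightarrow> real) \<Rightarrow> 'm \<Rightarrow> real \<Rightarrow> (real \<Rightarrow> real) \<Rightarrow> real \<Rightarrow> real \<Rightarrow> real" where
  "caputo_integrand T \<Phi> \<Theta> \<alpha> x t s =
     dm_kernel \<Phi> \<Theta> (1 - \<alpha>) (t - s) * vector_derivative x (at s within {0..T})"

definition caputo_dm ::
    "real \<Rightarrow> (real \<Rightarrow> 'm \<Rightarrow> real) \<Rightarrow> 'm \<Rightarrow> real \<Rightarrow> (real \<Rightarrow> real) \<Rightarrow> real \<Rightarrow> real" where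
  "caputo_dm T \<Phi> \<Theta> \<alpha> x t = (LBINT s:{0..t}. caputo_integrand T \<Phi> \<Theta> \<alpha> x t s)"

text \<open>
  Smooth enough for the derivative and the integrals defining the operator to exist; continuous
  differentiability on \<open>[0,T]\<close> suffices, see \<open>sufficiently_smooth_C1\<close> below.
\<close>

definition sufficiently_smooth ::
    "real \<Rightarrow> (real \<Rightarrow> 'm \<Rightarrow> real) \<Rightarrow> 'm \<Rightarrow> real \<Rightarrow> (real \<Rightarrow> real) \<Rightarrow> bool" where
  "sufficiently_smooth T \<Phi> \<Theta> \<alpha> x \<longleftrightarrow>
     x differentiable_on {0..T} \<and>
     (\<forall>t\<in>{0..T}. set_integrable lborel {0..t} (caputo_integrand T \<Phi> \<Theta> \<alpha> x t))"

lemma dm_kernel_laplace: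
  assumes "has_dm_kernel \<Phi> \<Theta> \<gamma>"
  shows "has_laplace_transform (dm_kernel \<Phi> \<Theta> \<gamma>) (\<lambda>p. \<Phi> p \<Theta> powr (- \<gamma>))"
  using assms unfolding has_dm_kernel_def dm_kernel_def inverse_laplace_def by (rule someI_ex)

lemma sufficiently_smooth_C1:
  assumes T: "T > 0" and ker: "has_dm_kernel \<Phi> \<Theta> (1 - \<alpha>)"
    and der: "\<And>s. s \<in> {0..T} \<Longrightarrow> (x has_real_derivative x' s) (at s within {0..T})"
    and cont: "continuous_on {0..T} x'"
  shows "sufficiently_smooth T \<Phi> \<Theta> \<alpha> x"
  unfolding sufficiently_smooth_def
proof (intro conjI ballI)
  show "x differentiable_on {0..T}"
    using der unfolding differentiable_on_def
    by (meson field_differentiable_def field_differentiable_imp_differentiable)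
next
  fix t assume t: "t \<in> {0..T}"
  define k where "k = dm_kernel \<Phi> \<Theta> (1 - \<alpha>)"
  have pt: "set_integrable lborel {c} f" for c and f :: "real \<Rightarrow> real"
  proof -
    have "(\<lambda>s. indicator {c} s *\<^sub>R f s) = (\<lambda>s. indicator {c} s *\<^sub>R f c)"
      by (auto simp: indicator_def)
    then show ?thesis unfolding set_integrable_def by simp
  qed
  have vd: "vector_derivative x (at s within {0..T}) = x' s" if "s \<in> {0..T}" for s
    by (rule vector_derivative_within_closed_interval[OF T that])
       (use der[OF that] has_real_derivative_iff_has_vector_derivative in blast)
  show "set_integrable lborel {0..t} (caputo_integrand T \<Phi> \<Theta> \<alpha> x t)"
  proof (cases "t = 0")
    case True
    have "set_integrable lborel {0..0} (caputo_integrand T \<Phi> \<Theta> \<alpha> x t)"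
      using pt by simp
    then show ?thesis using True by simp
  next
    case False
    with t have t0: "t > 0" by auto
    have "set_integrable lborel {0<..t} k"
      using dm_kernel_laplace[OF ker] t0 unfolding has_laplace_transform_def k_def by blast
    then have "integrable lborel (\<lambda>u. indicator {0<..t} u *\<^sub>R k u)"
      unfolding set_integrable_def .
    from lborel_integrable_real_affine[OF this, of "-1" t]
    have "integrable lborel (\<lambda>s. indicator {0<..t} (t - s) *\<^sub>R k (t - s))" by simp
    also have "(\<lambda>s. indicator {0<..t} (t - s) *\<^sub>R k (t - s)) = (\<lambda>s. indicator {0..<t} s *\<^sub>R k (t - s))"
      by (auto simp: indicator_def)
    finally have I: "integrable lborel (\<lambda>s. indicator {0..<t} s *\<^sub>R k (t - s))" .
    have c: "continuous_on {0..t} x'" using cont t by (auto intro: continuous_on_subset)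
    obtain B where B: "\<And>s. s \<in> {0..t} \<Longrightarrow> \<bar>x' s\<bar> \<le> B"
      using compact_imp_bounded[OF compact_continuous_image[OF c]] unfolding bounded_iff by force
    have m: "(\<lambda>s. indicator {0..t} s *\<^sub>R x' s) \<in> borel_measurable lborel"
      using borel_measurable_continuous_on_indicator[OF _ c] by simp
    have "integrable lborel (\<lambda>s. (indicator {0..t} s *\<^sub>R x' s) * (indicator {0..<t} s *\<^sub>R k (t - s)))"
    proof (rule Bochner_Integration.integrable_bound[OF integrable_mult_right[OF I, of "max B 0"]])
      show "AE s in lborel. norm ((indicator {0..t} s *\<^sub>R x' s) * (indicator {0..<t} s *\<^sub>R k (t - s)))
          \<le> norm (max B 0 * (indicator {0..<t} s *\<^sub>R k (t - s)))"
      proof (rule AE_I2)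
        fix s
        show "norm ((indicator {0..t} s *\<^sub>R x' s) * (indicator {0..<t} s *\<^sub>R k (t - s)))
          \<le> norm (max B 0 * (indicator {0..<t} s *\<^sub>R k (t - s)))"
          using B[of s] by (auto simp: indicator_def abs_mult intro!: mult_right_mono)
      qed
    qed (use m I in measurable)
    then have J: "set_integrable lborel {0..<t} (\<lambda>s. k (t - s) * x' s)"
      unfolding set_integrable_def
      by (rule Bochner_Integration.integrable_cong[THEN iffD1, rotated 2])
         (auto simp: indicator_def)
    have J2: "set_integrable lborel {0..<t} (caputo_integrand T \<Phi> \<Theta> \<alpha> x t)"
      using J t by (subst set_integrable_cong[OF refl refl])
                   (auto simp: caputo_integrand_def vd k_def)
    have "set_integrable lborel {t} (caputo_integrand T \<Phi> \<Theta> \<alpha> x t)"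
      by (rule pt)
    from set_integrable_Un[OF J2 this]
    have "set_integrable lborel ({0..<t} \<union> {t}) (caputo_integrand T \<Phi> \<Theta> \<alpha> x t)" by simp
    moreover have "{0..<t} \<union> {t} = {0..t}" using t0 by auto
    ultimately show ?thesis by (simp only:)
  qed
qed

end

theory Submission
  imports Defs
begin

text \<open>
  Once the memory kernel and the time \<open>t\<close> are fixed, the operator is differentiation followed by
  integration against the weight \<open>s \<mapsto> \<Psi>(t - s)\<close>, so linearity is inherited from both steps. The
  two parts of sufficient smoothness serve these two steps. Differentiability makes the integrand
  linear at every point of \<open>[0,T]\<close>; integrability allows the integral of the sum to be split, which
  matters because the Bochner integral of a non-integrable function has the default value 0.
\<close>

text \<open>
  Vector derivatives within a set are linear only where they are unique; on a nondegenerate closed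
  interval this holds at the endpoints too.
\<close>

lemma vector_derivative_linear_combination_within_Icc:
  fixes x y :: "real \<Rightarrow> 'a::euclidean_space"
  assumes "p < q" and s: "s \<in> {p..q}"
    and x: "x differentiable (at s within {p..q})" and y: "y differentiable (at s within {p..q})"
  shows "vector_derivative (\<lambda>u. a *\<^sub>R x u + b *\<^sub>R y u) (at s within {p..q}) =
    a *\<^sub>R vector_derivative x (at s within {p..q}) + b *\<^sub>R vector_derivative y (at s within {p..q})"
proof (rule vector_derivative_within_closed_interval[OF \<open>p < q\<close> s])
  have "(x has_vector_derivative vector_derivative x (at s within {p..q})) (at s within {p..q})"
    "(y has_vector_derivative vector_derivative y (at s within {p..q})) (at s within {p..q})"
    using x y vector_derivative_works by blast+
  then show "((\<lambda>u. a *\<^sub>R x u + b *\<^sub>R y u) has_vector_derivative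
      a *\<^sub>R vector_derivative x (at s within {p..q}) + b *\<^sub>R vector_derivative y (at s within {p..q}))
      (at s within {p..q})"
    by (intro has_vector_derivative_add
        bounded_linear.has_vector_derivative[OF bounded_linear_scaleR_right])
qed

lemma caputo_integrand_linear_combination:
  assumes "T > 0" and "x differentiable_on {0..T}" and "y differentiable_on {0..T}"
    and "s \<in> {0..T}"
  shows "caputo_integrand T \<Phi> \<Theta> \<alpha> (\<lambda>s. a * x s + b * y s) t s =
    a * caputo_integrand T \<Phi> \<Theta> \<alpha> x t s + b * caputo_integrand T \<Phi> \<Theta> \<alpha> y t s"
  using vector_derivative_linear_combination_within_Icc[of 0 T s x y a b] assms
  by (simp add: caputo_integrand_def differentiable_on_def algebra_simps)

theorem theorem3p25:
  fixes T \<alpha> a b t :: real and \<Phi> :: "real \<Rightarrow> 'm \<Rightarrow> real" and \<Theta> :: 'm and x y :: "real \<Rightarrow> real"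
  assumes "T > 0" and "0 < \<alpha>" and "\<alpha> < 1"
    and "dm_generator \<Phi> \<Theta>" and "has_dm_kernel \<Phi> \<Theta> (1 - \<alpha>)"
    and "sufficiently_smooth T \<Phi> \<Theta> \<alpha> x" and "sufficiently_smooth T \<Phi> \<Theta> \<alpha> y"
    and "t \<in> {0..T}"
  shows "caputo_dm T \<Phi> \<Theta> \<alpha> (\<lambda>s. a * x s + b * y s) t =
           a * caputo_dm T \<Phi> \<Theta> \<alpha> x t + b * caputo_dm T \<Phi> \<Theta> \<alpha> y t"
proof -
  let ?I = "\<lambda>f. caputo_integrand T \<Phi> \<Theta> \<alpha> f t"
  have int: "set_integrable lborel {0..t} (?I x)" "set_integrable lborel {0..t} (?I y)"
    and diff: "x differentiable_on {0..T}" "y differentiable_on {0..T}"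
    using assms unfolding sufficiently_smooth_def by blast+
  have "caputo_dm T \<Phi> \<Theta> \<alpha> (\<lambda>s. a * x s + b * y s) t = (LBINT s:{0..t}. a * ?I x s + b * ?I y s)"
    unfolding caputo_dm_def
    by (rule set_lebesgue_integral_cong)
       (use \<open>T > 0\<close> \<open>t \<in> {0..T}\<close> diff in \<open>auto intro!: caputo_integrand_linear_combination\<close>)
  also have "\<dots> = (LBINT s:{0..t}. a * ?I x s) + (LBINT s:{0..t}. b * ?I y s)"
    using int by (intro set_integral_add set_integrable_mult_right)
  also have "\<dots> = a * caputo_dm T \<Phi> \<Theta> \<alpha> x t + b * caputo_dm T \<Phi> \<Theta> \<alpha> y t"
    by (simp add: caputo_dm_def)
  finally show ?thesis .
qed

end
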